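(* Suppose a $\mathrm C^1$ solution $v_*:\mathcal X\to\mathbb R$ to the Hamilton–Jacobi–Bellman equation $$\alpha\,v_*(x)=\max_{u\in\mathcal U}h(x,u,\nabla v_*(x))\qquad\forall x\in\mathcal X$$ exists and is upper-bounded (by zero if $\gamma=1$). Then for any policy $\pi_*$ satisfying $\pi_*(x)\in\arg\max_{u\in\mathcal U}h(x,u,\nabla v_*(x))$ for all $x\in\mathcal X$: (a) $\pi_*$ is admissible and $v_*\le v_{\pi_*}$; (b) $v_\pi\le v_*$ if $\pi$ is a policy satisfying the boundary condition $$\lim_{t\to\infty}\mathbb G_\pi^x[\gamma^tv_*(X_t)]=0\qquad\forall x\in\mathcal X;$$ conversely, this boundary condition is true if $\pi$ is admissible and $v_\pi\le v_*$; (c) $v_*=v_{\pi_*}$ if either (i) the boundary condition in (b) is true for $\pi=\pi_*$, or (ii) $r_{\pi_*}\le\kappa\, v_*$ holds for a constant $\kappa>0$; (d) $(v_*,\pi_* )$ is optimal (i.e., $v_{\pi_*}=v_*$ and $v\le v_*$ for all $v\in\mathcal V_{\mathsf a}$) if $v\le v_*$ for any $v\in\mathcal V_{\mathsf a}$. Here all inequalities between functions are pointwise on $\mathcal X$.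
   Context: State space $\mathcal X=\mathbb R^l$, $\mathcal X^{\mathsf T}=\mathbb R^{1\times l}$, time space $\mathbb T=[0,\infty)$. The action space $\mathcal U\subseteq\mathbb R^m$ is an $m$-dimensional manifold with or without boundary, meaning $\mathcal U=O\cup\partial O$ or $\mathcal U=O$ for some open $O\subseteq\mathbb R^m$. The environment is $\dot X_t=f(X_t,U_t)$, with $f:\mathcal X\times\mathcal U\to\mathcal X$ continuous and $t\mapsto U_t\in\mathcal U$ continuous; it is a standing assumption that the state trajectory $t\mapsto X_t$ is uniquely defined over all of $\mathbb T$ (for every initial state, in particular under every policy). A policy is a continuous function $\pi:\mathcal X\to\mathcal U$. $\mathbb G_\pi^x[Y]$ denotes the value of $Y$ when $X_0=x$ and $U_t=\pi(X_t)$ for all $t\in\mathbb T$. The reward function $r:\mathcal X\times\mathcal U\to\mathbb R$ is continuous, $R_t=r(X_t,U_t)$, $r_\pi(x)=r(x,\pi(x))$; $\gamma\in(0,1]$ is the discount factor and $\alpha=-\ln\gamma\ge0$. Standing assumption: $r$ attains a maximum $r_{\mathsf{max}}$, and $r_{\mathsf{max}}=0$ if $\gamma=1$. The value function (VF) of $\pi$ is $v_\pi(x)=\mathbb G_\pi^x[\int_0^\infty\gamma^tR_t\,dt]\in[-\infty,\infty)$. A policy $\pi$ (and its VF) is admissible iff $v_\pi(x)$ is finite for all $x\in\mathcal X$; $\mathcal V_{\mathsf a}$ is the set of admissible VFs. Standing assumption: at least one admissible policy exists, and every admissible VF is $\mathrm C^1$. Gradients are row vectors, and the Hamiltonian is $h(x,u,p)=r(x,u)+p\,f(x,u)$.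 Standing assumption: there is a continuous $u_*:\mathcal X\times\mathcal X^{\mathsf T}\to\mathcal U$ with $u_*(x,p)\in\arg\max_{u\in\mathcal U}h(x,u,p)$ for all $(x,p)$. *)

theory Defs
  imports "HOL-Analysis.Analysis"
begin

definition solves_ode :: "(real \<Rightarrow> real^'l \<Rightarrow> real^'l) \<Rightarrow> real^'l \<Rightarrow> (real \<Rightarrow> real^'l) \<Rightarrow> bool" where
  "solves_ode F x X \<longleftrightarrow>
     X 0 = x \<and> (\<forall>t\<ge>0. (X has_vector_derivative F t (X t)) (at t within {0..}))"

text \<open>Trajectories are total functions on the reals of which only the restriction to
  \<open>{0..}\<close> matters, so uniqueness means agreement there.\<close>

definition uniquely_solvable :: "(real \<Rightarrow> real^'l \<Rightarrow> real^'l) \<Rightarrow> bool" where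
  "uniquely_solvable F \<longleftrightarrow>
     (\<forall>x. \<exists>X. solves_ode F x X \<and> (\<forall>Y. solves_ode F x Y \<longrightarrow> (\<forall>t\<ge>0. Y t = X t)))"

definition policy :: "(real^'m) set \<Rightarrow> (real^'l \<Rightarrow> real^'m) \<Rightarrow> bool" where
  "policy U \<pi> \<longleftrightarrow> continuous_on UNIV \<pi> \<and> (\<forall>x. \<pi> x \<in> U)"

definition action_trajectory :: "(real^'m) set \<Rightarrow> (real \<Rightarrow> real^'m) \<Rightarrow> bool" where
  "action_trajectory U a \<longleftrightarrow> continuous_on {0..} a \<and> (\<forall>t\<ge>0. a t \<in> U)"

text \<open>The state at time \<open>t\<close> when starting from \<open>x\<close> under \<open>\<pi>\<close>. For \<open>t \<ge> 0\<close> the choice is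
  immaterial whenever the closed loop is uniquely solvable.\<close>

definition state_under ::
  "(real^'l \<Rightarrow> real^'m \<Rightarrow> real^'l) \<Rightarrow> (real^'l \<Rightarrow> real^'m) \<Rightarrow> real^'l \<Rightarrow> real \<Rightarrow> real^'l" where
  "state_under f \<pi> x = (SOME X. solves_ode (\<lambda>t y. f y (\<pi> y)) x X)"

text \<open>The Lebesgue integral with values in the extended reals. It is meaningful if the positive or
  the negative part has a finite integral; in the intended use this holds for the positive part.\<close>

definition ext_integral :: "real set \<Rightarrow> (real \<Rightarrow> real) \<Rightarrow> ereal" where
  "ext_integral A g =
     enn2ereal (\<integral>\<^sup>+t\<in>A. ennreal (g t) \<partial>lborel) - enn2ereal (\<integral>\<^sup>+t\<in>A. ennreal (- g t) \<partial>lborel)"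

definition value_function ::
  "(real^'l \<Rightarrow> real^'m \<Rightarrow> real^'l) \<Rightarrow> (real^'l \<Rightarrow> real^'m \<Rightarrow> real) \<Rightarrow> real \<Rightarrow>
   (real^'l \<Rightarrow> real^'m) \<Rightarrow> real^'l \<Rightarrow> ereal" where
  "value_function f r \<gamma> \<pi> x =
     ext_integral {0..}
       (\<lambda>t. \<gamma> powr t * r (state_under f \<pi> x t) (\<pi> (state_under f \<pi> x t)))"

definition admissible ::
  "(real^'m) set \<Rightarrow> (real^'l \<Rightarrow> real^'m \<Rightarrow> real^'l) \<Rightarrow> (real^'l \<Rightarrow> real^'m \<Rightarrow> real) \<Rightarrow> real \<Rightarrow>
   (real^'l \<Rightarrow> real^'m) \<Rightarrow> bool" where
  "admissible U f r \<gamma> \<pi> \<longleftrightarrow> policy U \<pi> \<and> (\<forall>x. \<bar>value_function f r \<gamma> \<pi> x\<bar> \<noteq> \<infinity>)"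

definition admissible_VFs ::
  "(real^'m) set \<Rightarrow> (real^'l \<Rightarrow> real^'m \<Rightarrow> real^'l) \<Rightarrow> (real^'l \<Rightarrow> real^'m \<Rightarrow> real) \<Rightarrow> real \<Rightarrow>
   (real^'l \<Rightarrow> real) set" where
  "admissible_VFs U f r \<gamma> =
     {v. \<exists>\<pi>. admissible U f r \<gamma> \<pi> \<and> (\<forall>x. value_function f r \<gamma> \<pi> x = ereal (v x))}"

text \<open>Row vectors are identified with elements of \<open>real^'l\<close>, so the product of a row vector \<open>p\<close>
  with a column vector \<open>y\<close> is \<open>p \<bullet> y\<close>.\<close>

definition C1 :: "(real^'l \<Rightarrow> real) \<Rightarrow> bool" where
  "C1 v \<longleftrightarrow> (\<exists>g. continuous_on UNIV g \<and> (\<forall>x. GDERIV v x :> g x))"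

definition grad :: "(real^'l \<Rightarrow> real) \<Rightarrow> real^'l \<Rightarrow> real^'l" where
  "grad v x = (THE g. GDERIV v x :> g)"

definition hamiltonian ::
  "(real^'l \<Rightarrow> real^'m \<Rightarrow> real^'l) \<Rightarrow> (real^'l \<Rightarrow> real^'m \<Rightarrow> real) \<Rightarrow>
   real^'l \<Rightarrow> real^'m \<Rightarrow> real^'l \<Rightarrow> real" where
  "hamiltonian f r x u p = r x u + p \<bullet> f x u"

definition greedy_action ::
  "(real^'m) set \<Rightarrow> (real^'l \<Rightarrow> real^'m \<Rightarrow> real^'l) \<Rightarrow> (real^'l \<Rightarrow> real^'m \<Rightarrow> real) \<Rightarrow>
   real^'l \<Rightarrow> real^'l \<Rightarrow> real^'m \<Rightarrow> bool" where
  "greedy_action U f r x p u \<longleftrightarrow> is_arg_max (\<lambda>w. hamiltonian f r x w p) (\<lambda>w. w \<in> U) u"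

text \<open>The right-hand side of the equation is a maximum, so it has to be attained.\<close>

definition HJB_solution ::
  "(real^'m) set \<Rightarrow> (real^'l \<Rightarrow> real^'m \<Rightarrow> real^'l) \<Rightarrow> (real^'l \<Rightarrow> real^'m \<Rightarrow> real) \<Rightarrow> real \<Rightarrow>
   (real^'l \<Rightarrow> real) \<Rightarrow> bool" where
  "HJB_solution U f r \<alpha> v \<longleftrightarrow>
     (\<forall>x. \<exists>u. greedy_action U f r x (grad v x) u \<and> \<alpha> * v x = hamiltonian f r x u (grad v x))"

definition boundary_condition ::
  "(real^'l \<Rightarrow> real^'m \<Rightarrow> real^'l) \<Rightarrow> real \<Rightarrow> (real^'l \<Rightarrow> real) \<Rightarrow> (real^'l \<Rightarrow> real^'m) \<Rightarrow> bool" where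
  "boundary_condition f \<gamma> v \<pi> \<longleftrightarrow>
     (\<forall>x. ((\<lambda>t. \<gamma> powr t * v (state_under f \<pi> x t)) \<longlongrightarrow> 0) at_top)"

end

theory Submission
  imports Defs
begin

text \<open>Along a closed-loop trajectory the derivative of \<open>\<gamma>\<^sup>t v (X\<^sub>t)\<close> is
  \<open>\<gamma>\<^sup>t (\<nabla>v \<bullet> f - \<alpha> v)\<close>, which the HJB equation bounds by \<open>- \<gamma>\<^sup>t R\<^sub>t\<close>, with equality for a greedy
  policy. Integrating, \<open>v x\<close> dominates the reward collected up to time \<open>T\<close> plus
  \<open>\<gamma>\<^sup>T v (X\<^sub>T)\<close>, with equality for a greedy policy; all claims result from letting \<open>T\<close> tend to
  infinity. The collected reward converges in \<open>[-\<infinity>, \<infinity>)\<close> because the reward is bounded above.\<close>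

section \<open>Improper integrals as limits over growing intervals\<close>

text \<open>Monotone convergence gives the limit along integer endpoints, and monotonicity in the
  endpoint extends it to all real \<open>T\<close>. The limit may be infinite.\<close>

lemma ext_integral_tendsto_nonneg:
  fixes h :: "real \<Rightarrow> real"
  assumes cont: "continuous_on {0..} h" and nonneg: "\<And>t. t \<ge> 0 \<Longrightarrow> 0 \<le> h t"
  shows "((\<lambda>T. ereal (integral {0..T} h)) \<longlongrightarrow> enn2ereal (\<integral>\<^sup>+t\<in>{0..}. ennreal (h t) \<partial>lborel)) at_top"
proof -
  define L where "L = (\<integral>\<^sup>+t\<in>{0..}. ennreal (h t) \<partial>lborel)"
  define F where "F T = (\<integral>\<^sup>+t. ennreal (h t) * indicator {0..T} t \<partial>lborel)" for T
  have hint: "h integrable_on {0..T}" for T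
    by (rule integrable_continuous_interval) (rule continuous_on_subset[OF cont], auto)
  have F: "F T = ennreal (integral {0..T} h)" for T
    unfolding F_def using nonneg
    by (intro nn_integral_has_integral_lebesgue' integrable_integral hint) auto
  have F_mono: "F S \<le> F T" if "S \<le> T" for S T
    unfolding F_def using that by (intro nn_integral_mono mult_left_mono) (auto split: split_indicator)
  have F_le: "F T \<le> L" for T
    unfolding F_def L_def by (intro nn_integral_mono mult_left_mono) (auto split: split_indicator)
  have L_SUP: "L = (SUP n::nat. F (real n))"
  proof -
    have meas: "(\<lambda>t. ennreal (h t) * indicator {0..real n} t) \<in> borel_measurable lborel" for n
    proof -
      \<comment> \<open>Nothing is known about \<open>h\<close> at negative times, so measurability
        is obtained only after cutting \<open>h\<close> off to an interval on which it is
        continuous.\<close>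
      have "(\<lambda>t. indicator {0..real n} t *\<^sub>R h t) \<in> borel_measurable borel"
        by (rule borel_measurable_continuous_on_indicator)
           (auto intro: continuous_on_subset[OF cont])
      then have "(\<lambda>t. ennreal (indicator {0..real n} t *\<^sub>R h t)) \<in> borel_measurable lborel"
        by simp
      also have "(\<lambda>t. ennreal (indicator {0..real n} t *\<^sub>R h t))
          = (\<lambda>t. ennreal (h t) * indicator {0..real n} t)"
        by (auto split: split_indicator)
      finally show ?thesis .
    qed
    have "L = (\<integral>\<^sup>+t. (SUP n::nat. ennreal (h t) * indicator {0..real n} t) \<partial>lborel)"
      unfolding L_def
    proof (rule nn_integral_cong)
      fix t :: real
      show "ennreal (h t) * indicator {0..} t = (SUP n::nat. ennreal (h t) * indicator {0..real n} t)"
      \<comment> \<open>At a fixed \<open>t\<close> the supremum is reached by any \<open>n\<close>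
        beyond \<open>t\<close>.\<close>
      proof (rule antisym)
        obtain n :: nat where "t \<le> real n" using real_arch_simple by blast
        then have "ennreal (h t) * indicator {0..} t \<le> ennreal (h t) * indicator {0..real n} t"
          by (auto split: split_indicator)
        then show "ennreal (h t) * indicator {0..} t
            \<le> (SUP n::nat. ennreal (h t) * indicator {0..real n} t)"
          by (meson SUP_upper2 UNIV_I)
      qed (auto intro!: SUP_least mult_left_mono split: split_indicator)
    qed
    also have "\<dots> = (SUP n::nat. F (real n))"
      unfolding F_def
      by (rule nn_integral_monotone_convergence_SUP[OF _ meas])
         (auto simp: incseq_def le_fun_def split: split_indicator)
    finally show ?thesis .
  qed
  have "(F \<longlongrightarrow> L) at_top"
  proof (rule order_tendstoI)
    fix a assume "a < L"
    then obtain n :: nat where "a < F (real n)"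
      unfolding L_SUP by (auto simp: less_SUP_iff)
    then have "a < F T" if "real n \<le> T" for T
      using F_mono[OF that] by (rule less_le_trans)
    then show "eventually (\<lambda>T. a < F T) at_top"
      unfolding eventually_at_top_linorder by blast
  qed (use F_le le_less_trans in \<open>blast intro: always_eventually\<close>)
  then have "((\<lambda>T. enn2ereal (F T)) \<longlongrightarrow> enn2ereal L) at_top"
    by (rule tendsto_enn2erealI)
  moreover have "enn2ereal (F T) = ereal (integral {0..T} h)" for T
    unfolding F by (rule enn2ereal_ennreal) (auto intro!: integral_nonneg hint nonneg)
  ultimately show ?thesis by (simp add: L_def)
qed

text \<open>The nonnegative case applies to the positive and the negative part separately.
  Finiteness of the positive part excludes the form \<open>\<infinity> - \<infinity>\<close>, while
  the negative part may diverge and give the value \<open>-\<infinity>\<close>.\<close>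

lemma ext_integral_tendsto:
  fixes g :: "real \<Rightarrow> real"
  assumes cont: "continuous_on {0..} g"
    and fin: "(\<integral>\<^sup>+t\<in>{0..}. ennreal (g t) \<partial>lborel) < \<infinity>"
  shows "((\<lambda>T. ereal (integral {0..T} g)) \<longlongrightarrow> ext_integral {0..} g) at_top"
    and "ext_integral {0..} g < \<infinity>"
proof -
  let ?P = "enn2ereal (\<integral>\<^sup>+t\<in>{0..}. ennreal (g t) \<partial>lborel)"
  let ?N = "enn2ereal (\<integral>\<^sup>+t\<in>{0..}. ennreal (- g t) \<partial>lborel)"
  \<comment> \<open>\<open>ennreal\<close> truncates negative numbers to 0, so the integrands in
    \<open>ext_integral\<close> are already the positive and negative parts, which are continuous as
    real functions.\<close>
  have max: "ennreal (max c 0) = ennreal c" for c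
    by (simp add: ennreal_neg max_def)
  have cp: "continuous_on {0..} (\<lambda>t. max (g t) 0)" and cn: "continuous_on {0..} (\<lambda>t. max (- g t) 0)"
    by (intro continuous_intros cont)+
  have int: "k integrable_on {0..T}" if "continuous_on {0..} k" for k :: "real \<Rightarrow> real" and T
    by (rule integrable_continuous_interval) (rule continuous_on_subset[OF that], auto)
  have P: "((\<lambda>T. ereal (integral {0..T} (\<lambda>t. max (g t) 0))) \<longlongrightarrow> ?P) at_top"
    using ext_integral_tendsto_nonneg[OF cp] by (simp add: max)
  have N: "((\<lambda>T. ereal (integral {0..T} (\<lambda>t. max (- g t) 0))) \<longlongrightarrow> ?N) at_top"
    using ext_integral_tendsto_nonneg[OF cn] by (simp add: max)
  have P_fin: "\<bar>?P\<bar> \<noteq> \<infinity>"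
    using fin by (cases "\<integral>\<^sup>+t\<in>{0..}. ennreal (g t) \<partial>lborel") (auto simp: enn2ereal_ennreal)
  have "integral {0..T} g
      = integral {0..T} (\<lambda>t. max (g t) 0) - integral {0..T} (\<lambda>t. max (- g t) 0)" for T
  proof -
    have "integral {0..T} (\<lambda>t. max (g t) 0) - integral {0..T} (\<lambda>t. max (- g t) 0)
        = integral {0..T} (\<lambda>t. max (g t) 0 - max (- g t) 0)"
      by (rule integral_diff[symmetric]) (intro int cp cn)+
    also have "(\<lambda>t. max (g t) 0 - max (- g t) 0) = g"
      by (auto simp: max_def)
    finally show ?thesis by simp
  qed
  then show "((\<lambda>T. ereal (integral {0..T} g)) \<longlongrightarrow> ext_integral {0..} g) at_top"
    unfolding ext_integral_def
    using tendsto_diff_ereal_general[OF P N] P_fin by auto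
  have "0 \<le> ?N" by simp
  then show "ext_integral {0..} g < \<infinity>"
    unfolding ext_integral_def using P_fin by (cases ?P; cases ?N) auto
qed

text \<open>For \<gamma> < 1 the majorant is a decaying exponential with finite integral; for
  \<gamma> = 1 it is zero, and the positive part of \<open>g\<close> vanishes on
  \<open>{0..}\<close>.\<close>

lemma nn_integral_discounted_finite:
  fixes g :: "real \<Rightarrow> real"
  assumes gamma: "0 < \<gamma>" "\<gamma> \<le> 1" and M: "0 \<le> M" "\<gamma> = 1 \<Longrightarrow> M = 0"
    and le: "\<And>t. 0 \<le> t \<Longrightarrow> g t \<le> M * \<gamma> powr t"
  shows "(\<integral>\<^sup>+t\<in>{0..}. ennreal (g t) \<partial>lborel) < \<infinity>"
proof (cases "\<gamma> = 1")
  case True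
  then have "(\<lambda>t. ennreal (g t) * indicator {0..} t) = (\<lambda>t. 0)"
    using le M by (fastforce split: split_indicator simp: ennreal_neg)
  then show ?thesis by simp
next
  case False
  define a where "a = - ln \<gamma>"
  have a: "0 < a" using gamma False by (simp add: a_def)
  have "((\<lambda>t. M * exp (- a * t)) has_integral M * (exp (- a * 0) / a)) {0..}"
    by (intro has_integral_mult_right has_integral_exp_minus_to_infinity a)
  then have "(\<integral>\<^sup>+t\<in>{0..}. ennreal (M * exp (- a * t)) \<partial>lborel) = ennreal (M * (exp (- a * 0) / a))"
    using M by (intro nn_integral_has_integral_lebesgue') auto
  then have "(\<integral>\<^sup>+t\<in>{0..}. ennreal (M * exp (- a * t)) \<partial>lborel) < \<infinity>"
    by simp
  moreover have "(\<integral>\<^sup>+t\<in>{0..}. ennreal (g t) \<partial>lborel)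
      \<le> (\<integral>\<^sup>+t\<in>{0..}. ennreal (M * exp (- a * t)) \<partial>lborel)"
    using le gamma
    by (intro nn_integral_mono) (auto split: split_indicator simp: a_def powr_def mult.commute
        intro!: ennreal_leI)
  ultimately show ?thesis by (rule order.strict_trans1[rotated])
qed

text \<open>\<open>grad\<close> is a definite description and denotes the gradient only once
  uniqueness is known: a vector is determined by its inner products.\<close>

lemma GDERIV_grad:
  assumes "C1 v"
  shows "GDERIV v x :> grad v x"
proof -
  obtain g where g: "GDERIV v x :> g" using assms unfolding C1_def by blast
  have unique: "g' = g" if "GDERIV v x :> g'" for g'
  proof -
    have "(\<lambda>h. h \<bullet> g') = (\<lambda>h. h \<bullet> g)"
      using that g unfolding gderiv_def by (rule has_derivative_unique)
    then have "\<forall>h. h \<bullet> g' = h \<bullet> g" by (simp add: fun_eq_iff)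
    then show ?thesis by (simp only: vector_eq_ldot)
  qed
  have "grad v x = g"
    unfolding grad_def by (intro the_equality g unique)
  then show ?thesis using g by simp
qed

section \<open>Closed-loop trajectories and their values\<close>

text \<open>\<open>M\<close> is a nonnegative bound on the reward rather than its maximum, so that
  \<open>M * \<gamma> powr t\<close> also dominates the positive part of the discounted
  reward.\<close>

locale discounted_system =
  fixes U :: "(real^'m) set"
    and f :: "real^'l \<Rightarrow> real^'m \<Rightarrow> real^'l"
    and r :: "real^'l \<Rightarrow> real^'m \<Rightarrow> real"
    and \<gamma> M :: real
  assumes closed_loop: "\<And>\<pi>. policy U \<pi> \<Longrightarrow> uniquely_solvable (\<lambda>t y. f y (\<pi> y))"
    and r_cont: "continuous_on (UNIV \<times> U) (\<lambda>(x, u). r x u)"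
    and gamma: "0 < \<gamma>" "\<gamma> \<le> 1"
    and r_bound: "\<And>x u. u \<in> U \<Longrightarrow> r x u \<le> M"
    and M_nonneg: "0 \<le> M" and M_zero: "\<gamma> = 1 \<Longrightarrow> M = 0"
begin

abbreviation reward_at :: "(real^'l \<Rightarrow> real^'m) \<Rightarrow> real^'l \<Rightarrow> real \<Rightarrow> real" where
  "reward_at \<pi> x t \<equiv> \<gamma> powr t * r (state_under f \<pi> x t) (\<pi> (state_under f \<pi> x t))"

lemma state_under_solves:
  assumes "policy U \<pi>"
  shows "solves_ode (\<lambda>t y. f y (\<pi> y)) x (state_under f \<pi> x)"
  unfolding state_under_def
  using closed_loop[OF assms] unfolding uniquely_solvable_def by (metis someI_ex)

lemma state_under_0: "policy U \<pi> \<Longrightarrow> state_under f \<pi> x 0 = x"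
  using state_under_solves unfolding solves_ode_def by blast

lemma state_under_deriv:
  assumes "policy U \<pi>" "0 \<le> t"
  shows "(state_under f \<pi> x has_vector_derivative
      f (state_under f \<pi> x t) (\<pi> (state_under f \<pi> x t))) (at t within {0..})"
  using state_under_solves[OF assms(1), of x] assms(2) unfolding solves_ode_def by blast

text \<open>The closed loop is autonomous, so the trajectory shifted by \<open>T\<close> solves the
  same equation from the state at time \<open>T\<close>; uniqueness identifies the two.\<close>

lemma state_under_shift:
  assumes pol: "policy U \<pi>" and T: "0 \<le> T" and s: "0 \<le> s"
  shows "state_under f \<pi> (state_under f \<pi> x T) s = state_under f \<pi> x (s + T)"
proof -
  let ?X = "state_under f \<pi> x"
  have "((?X \<circ> (\<lambda>s. s + T)) has_vector_derivative 1 *\<^sub>R f (?X (t + T)) (\<pi> (?X (t + T))))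
      (at t within {0..})" if "0 \<le> t" for t
  proof (rule vector_diff_chain_within)
    show "((\<lambda>s. s + T) has_vector_derivative 1) (at t within {0..})"
      by (auto intro!: derivative_eq_intros)
    show "(?X has_vector_derivative f (?X (t + T)) (\<pi> (?X (t + T))))
        (at (t + T) within (\<lambda>s. s + T) ` {0..})"
      using that T
      by (intro has_vector_derivative_within_subset[OF state_under_deriv[OF pol]]) auto
  qed
  then have "solves_ode (\<lambda>t y. f y (\<pi> y)) (?X T) (\<lambda>s. ?X (s + T))"
    unfolding solves_ode_def by (auto simp: o_def)
  then show ?thesis
    using closed_loop[OF pol] state_under_solves[OF pol, of "?X T"] s
    unfolding uniquely_solvable_def by metis
qed

lemma continuous_state_under: "policy U \<pi> \<Longrightarrow> continuous_on {0..} (state_under f \<pi> x)"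
  by (auto intro!: has_vector_derivative_continuous state_under_deriv simp: continuous_on_eq_continuous_within)

lemma continuous_reward_at:
  assumes pol: "policy U \<pi>"
  shows "continuous_on {0..} (reward_at \<pi> x)"
proof -
  let ?X = "state_under f \<pi> x"
  have "continuous_on {0..} (\<lambda>t. \<pi> (?X t))"
    using pol continuous_state_under[OF pol] unfolding policy_def
    by (auto intro: continuous_on_compose2)
  then have "continuous_on {0..} (\<lambda>t. (?X t, \<pi> (?X t)))"
    by (intro continuous_intros continuous_state_under[OF pol])
  then have "continuous_on {0..} (\<lambda>t. (\<lambda>(x, u). r x u) (?X t, \<pi> (?X t)))"
    by (rule continuous_on_compose2[OF r_cont]) (use pol in \<open>auto simp: policy_def\<close>)
  moreover have "continuous_on {0..} (\<lambda>t. \<gamma> powr t)"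
    by (intro continuous_intros) (use gamma in auto)
  ultimately show ?thesis
    by (auto intro: continuous_on_mult)
qed

text \<open>This replaces the Lebesgue integral by limits of finite-horizon rewards, the only form
  in which the value is used below. The limit can be \<open>-\<infinity>\<close> but not
  \<open>\<infinity>\<close>.\<close>

lemma value_tendsto:
  assumes pol: "policy U \<pi>"
  shows "((\<lambda>T. ereal (integral {0..T} (reward_at \<pi> x))) \<longlongrightarrow> value_function f r \<gamma> \<pi> x) at_top"
    and "value_function f r \<gamma> \<pi> x < \<infinity>"
proof -
  have "(\<integral>\<^sup>+t\<in>{0..}. ennreal (reward_at \<pi> x t) \<partial>lborel) < \<infinity>"
  proof (rule nn_integral_discounted_finite[OF gamma M_nonneg M_zero])
    fix t :: real
    show "reward_at \<pi> x t \<le> M * \<gamma> powr t"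
      using pol r_bound by (subst mult.commute) (auto simp: policy_def intro!: mult_right_mono)
  qed
  note * = ext_integral_tendsto[OF continuous_reward_at[OF pol] this]
  show "((\<lambda>T. ereal (integral {0..T} (reward_at \<pi> x))) \<longlongrightarrow> value_function f r \<gamma> \<pi> x) at_top"
    "value_function f r \<gamma> \<pi> x < \<infinity>"
    using * unfolding value_function_def by auto
qed

lemma reward_integrable: "policy U \<pi> \<Longrightarrow> 0 \<le> S \<Longrightarrow> reward_at \<pi> x integrable_on {S..T}"
  by (rule integrable_continuous_interval, rule continuous_on_subset[OF continuous_reward_at]) auto

text \<open>Dynamic programming: discounting the value at the state reached at time \<open>T\<close>
  back to time 0 gives the tail of the convergent reward integral from \<open>x\<close>.\<close>

lemma value_at_state:
  assumes pol: "policy U \<pi>" and T: "0 \<le> T"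
    and v: "value_function f r \<gamma> \<pi> x = ereal V"
    and w: "value_function f r \<gamma> \<pi> (state_under f \<pi> x T) = ereal W"
  shows "\<gamma> powr T * W = V - integral {0..T} (reward_at \<pi> x)"
proof -
  let ?G = "\<lambda>S. integral {0..S} (reward_at \<pi> x)"
  have "((\<lambda>S. ereal (?G S)) \<longlongrightarrow> ereal V) at_top"
    using value_tendsto(1)[OF pol, of x] unfolding v .
  then have V: "(?G \<longlongrightarrow> V) at_top" by simp
  have "filterlim (\<lambda>S. S + T) at_top at_top"
    unfolding add.commute[of _ T]
    by (rule filterlim_tendsto_add_at_top[OF tendsto_const filterlim_ident])
  from filterlim_compose[OF V this]
  have 1: "((\<lambda>S. ?G (S + T) - ?G T) \<longlongrightarrow> V - ?G T) at_top"
    by (intro tendsto_intros)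
  have "((\<lambda>S. ereal (integral {0..S} (reward_at \<pi> (state_under f \<pi> x T)))) \<longlongrightarrow> ereal W) at_top"
    using value_tendsto(1)[OF pol, of "state_under f \<pi> x T"] unfolding w .
  then have 2: "((\<lambda>S. \<gamma> powr T * integral {0..S} (reward_at \<pi> (state_under f \<pi> x T)))
      \<longlongrightarrow> \<gamma> powr T * W) at_top"
    by (intro tendsto_intros) simp
  have "eventually (\<lambda>S. \<gamma> powr T * integral {0..S} (reward_at \<pi> (state_under f \<pi> x T))
      = ?G (S + T) - ?G T) at_top"
    using eventually_ge_at_top[of 0]
  proof eventually_elim
    case (elim S)
    have "\<gamma> powr T * integral {0..S} (reward_at \<pi> (state_under f \<pi> x T))
        = integral {0..S} (\<lambda>s. \<gamma> powr T * reward_at \<pi> (state_under f \<pi> x T) s)"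
      by simp
    \<comment> \<open>The factor \<open>\<gamma> powr T\<close> turns discounting from time
      \<open>T\<close> into discounting from time 0, and the shift property matches the
      states.\<close>
    also have "\<dots> = integral {0..S} (reward_at \<pi> x \<circ> (\<lambda>s. s + T))"
      by (intro integral_cong) (use T in \<open>auto simp: state_under_shift[OF pol] powr_add\<close>)
    also have "\<dots> = integral {0 + T..S + T} (reward_at \<pi> x)"
      by (rule integral_shift) (use T in \<open>auto intro: continuous_on_subset[OF continuous_reward_at[OF pol]]\<close>)
    also have "\<dots> = ?G (S + T) - ?G T"
      using Henstock_Kurzweil_Integration.integral_combine[of 0 T "S + T" "reward_at \<pi> x"] T elim reward_integrable[OF pol]
      by simp
    finally show ?case .
  qed
  then have "((\<lambda>S. ?G (S + T) - ?G T) \<longlongrightarrow> \<gamma> powr T * W) at_top"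
    using 2 by (simp cong: tendsto_cong)
  \<comment> \<open>Both sides are limits of the same tail integrals.\<close>
  from tendsto_unique[OF _ this 1] show ?thesis by simp
qed

text \<open>The chain rule along the trajectory and the product rule give the integrand, and the
  fundamental theorem of calculus integrates it. The term with \<open>ln \<gamma>\<close> comes from
  differentiating the discount factor.\<close>

lemma discounted_state_integral:
  assumes pol: "policy U \<pi>" and C1: "C1 v" and T: "0 \<le> T"
  shows "((\<lambda>t. \<gamma> powr t * (grad v (state_under f \<pi> x t) \<bullet>
              f (state_under f \<pi> x t) (\<pi> (state_under f \<pi> x t)) + ln \<gamma> * v (state_under f \<pi> x t)))
          has_integral (\<gamma> powr T * v (state_under f \<pi> x T) - v x)) {0..T}"
proof -
  let ?X = "state_under f \<pi> x"
  have "((\<lambda>t. \<gamma> powr t * v (?X t)) has_vector_derivative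
      \<gamma> powr t * (grad v (?X t) \<bullet> f (?X t) (\<pi> (?X t)) + ln \<gamma> * v (?X t))) (at t within {0..T})"
    if t: "t \<in> {0..T}" for t
  proof -
    have X: "(?X has_derivative (\<lambda>h. h *\<^sub>R f (?X t) (\<pi> (?X t)))) (at t within {0..T})"
      using has_vector_derivative_within_subset[OF state_under_deriv[OF pol, of t x], of "{0..T}"] t
      by (auto simp: has_vector_derivative_def)
    have v: "(v has_derivative (\<lambda>h. h \<bullet> grad v (?X t))) (at (?X t))"
      using GDERIV_grad[OF C1] unfolding gderiv_def .
    have "((\<lambda>t. v (?X t)) has_derivative (\<lambda>h. (h *\<^sub>R f (?X t) (\<pi> (?X t))) \<bullet> grad v (?X t)))
        (at t within {0..T})"
      by (rule has_derivative_compose[OF X v])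
    then have 1: "((\<lambda>t. v (?X t)) has_real_derivative grad v (?X t) \<bullet> f (?X t) (\<pi> (?X t)))
        (at t within {0..T})"
      by (rule has_derivative_imp_has_field_derivative) (simp add: inner_commute mult.commute)
    have 2: "((\<lambda>t. \<gamma> powr t) has_real_derivative \<gamma> powr t * ln \<gamma>) (at t within {0..T})"
      using gamma unfolding powr_def by (auto intro!: derivative_eq_intros simp: powr_def)
    from DERIV_mult[OF 2 1] show ?thesis
      by (simp add: has_real_derivative_iff_has_vector_derivative algebra_simps)
  qed
  from fundamental_theorem_of_calculus[OF T this] show ?thesis
    using state_under_0[OF pol] gamma by simp
qed

section \<open>Consequences of the HJB equation\<close>

context
  fixes v :: "real^'l \<Rightarrow> real"
  assumes C1: "C1 v" and HJB: "HJB_solution U f r (- ln \<gamma>) v"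
begin

lemma HJB_ge: "u \<in> U \<Longrightarrow> hamiltonian f r x u (grad v x) \<le> - ln \<gamma> * v x"
  using HJB unfolding HJB_solution_def greedy_action_def is_arg_max_linorder by metis

text \<open>The equation names only some maximizer, but all maximizers share the same Hamiltonian
  value.\<close>

lemma HJB_eq:
  assumes "greedy_action U f r x (grad v x) u"
  shows "hamiltonian f r x u (grad v x) = - ln \<gamma> * v x"
proof -
  obtain u' where u': "greedy_action U f r x (grad v x) u'"
    "- ln \<gamma> * v x = hamiltonian f r x u' (grad v x)"
    using HJB unfolding HJB_solution_def by blast
  then show ?thesis
    using assms unfolding greedy_action_def is_arg_max_linorder by (metis antisym)
qed

lemma HJB_integral_le:
  assumes pol: "policy U \<pi>" and T: "0 \<le> T"
  shows "integral {0..T} (reward_at \<pi> x) + \<gamma> powr T * v (state_under f \<pi> x T) \<le> v x"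
proof -
  let ?X = "state_under f \<pi> x"
  have "\<gamma> powr T * v (?X T) - v x \<le> - integral {0..T} (reward_at \<pi> x)"
  proof (rule has_integral_le[OF discounted_state_integral[OF pol C1 T]])
    show "((\<lambda>t. - reward_at \<pi> x t) has_integral - integral {0..T} (reward_at \<pi> x)) {0..T}"
      by (intro has_integral_neg integrable_integral reward_integrable pol) simp
    fix t
    have "grad v (?X t) \<bullet> f (?X t) (\<pi> (?X t)) + ln \<gamma> * v (?X t) \<le> - r (?X t) (\<pi> (?X t))"
      using HJB_ge[of "\<pi> (?X t)" "?X t"] pol unfolding hamiltonian_def policy_def by simp
    then show "\<gamma> powr t * (grad v (?X t) \<bullet> f (?X t) (\<pi> (?X t)) + ln \<gamma> * v (?X t))
        \<le> - reward_at \<pi> x t"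
      by (subst mult_minus_right[symmetric]) (intro mult_left_mono, auto)
  qed
  then show ?thesis by simp
qed

lemma HJB_integral_eq:
  assumes pol: "policy U \<pi>" and T: "0 \<le> T"
    and greedy: "\<And>x. greedy_action U f r x (grad v x) (\<pi> x)"
  shows "integral {0..T} (reward_at \<pi> x) + \<gamma> powr T * v (state_under f \<pi> x T) = v x"
proof -
  let ?X = "state_under f \<pi> x"
  have "grad v (?X t) \<bullet> f (?X t) (\<pi> (?X t)) + ln \<gamma> * v (?X t) = - r (?X t) (\<pi> (?X t))" for t
    using HJB_eq[OF greedy, of "?X t"] unfolding hamiltonian_def by simp
  then have "((\<lambda>t. - reward_at \<pi> x t) has_integral (\<gamma> powr T * v (?X T) - v x)) {0..T}"
    using discounted_state_integral[OF pol C1 T, of x] by simp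
  then have "integral {0..T} (\<lambda>t. - reward_at \<pi> x t) = \<gamma> powr T * v (?X T) - v x"
    by (rule integral_unique)
  then show ?thesis by simp
qed

text \<open>The collected reward is at most \<open>v x\<close> minus the discounted terminal term,
  which vanishes in the limit by the boundary condition.\<close>

lemma value_le_of_boundary_condition:
  assumes pol: "policy U \<pi>" and bc: "boundary_condition f \<gamma> v \<pi>"
  shows "value_function f r \<gamma> \<pi> x \<le> ereal (v x)"
proof (rule tendsto_le[OF _ _ value_tendsto(1)[OF pol]])
  let ?\<phi> = "\<lambda>T. \<gamma> powr T * v (state_under f \<pi> x T)"
  have "((\<lambda>T. v x - ?\<phi> T) \<longlongrightarrow> v x - 0) at_top"
    using bc unfolding boundary_condition_def by (intro tendsto_intros) auto
  then show "((\<lambda>T. ereal (v x - ?\<phi> T)) \<longlongrightarrow> ereal (v x)) at_top" by simp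
  show "eventually (\<lambda>T. ereal (integral {0..T} (reward_at \<pi> x)) \<le> ereal (v x - ?\<phi> T)) at_top"
    using eventually_ge_at_top[of 0]
    by eventually_elim (use HJB_integral_le[OF pol] in \<open>simp add: le_diff_eq\<close>)
qed simp

section \<open>Solutions that are bounded above\<close>

context
  fixes c :: real
  assumes v_le: "\<And>x. v x \<le> c" and c_zero: "\<gamma> = 1 \<Longrightarrow> c = 0"
begin

text \<open>This makes the limit superior of \<open>\<gamma> powr t * v\<close> along any trajectory
  at most 0, which is the upper half of the boundary condition.\<close>

lemma discounted_bound_tendsto: "((\<lambda>t. \<gamma> powr t * c) \<longlongrightarrow> 0) at_top"
proof (cases "\<gamma> = 1")
  case False
  then have "((\<lambda>t. \<gamma> powr t) \<longlongrightarrow> 0) at_top"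
    using gamma unfolding powr_def mult.commute[of _ "ln \<gamma>"]
    by (auto intro!: filterlim_compose[OF exp_at_bot]
        filterlim_tendsto_neg_mult_at_bot[OF tendsto_const] filterlim_ident)
  then show ?thesis by (auto intro: tendsto_mult_left_zero)
qed (simp add: c_zero)

lemma boundary_condition_of_value_le:
  assumes adm: "admissible U f r \<gamma> \<pi>" and le: "\<And>x. value_function f r \<gamma> \<pi> x \<le> ereal (v x)"
  shows "boundary_condition f \<gamma> v \<pi>"
  unfolding boundary_condition_def
proof
  fix x
  have pol: "policy U \<pi>" using adm by (simp add: admissible_def)
  \<comment> \<open>Admissibility makes the value finite at every state, so the limits can be taken
    in the reals and \<open>value_at_state\<close> applies at \<open>x\<close> and along its
    trajectory.\<close>
  define w where "w y = real_of_ereal (value_function f r \<gamma> \<pi> y)" for y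
  have w: "value_function f r \<gamma> \<pi> y = ereal (w y)" for y
    using adm unfolding w_def admissible_def by (simp add: ereal_real')
  have "((\<lambda>T. ereal (integral {0..T} (reward_at \<pi> x))) \<longlongrightarrow> ereal (w x)) at_top"
    using value_tendsto(1)[OF pol, of x] unfolding w .
  then have "((\<lambda>T. w x - integral {0..T} (reward_at \<pi> x)) \<longlongrightarrow> w x - w x) at_top"
    by (intro tendsto_intros) simp
  then have lower: "((\<lambda>T. w x - integral {0..T} (reward_at \<pi> x)) \<longlongrightarrow> 0) at_top" by simp
  \<comment> \<open>The lower bound is \<open>\<gamma>\<^sup>T v\<^sub>\<pi> (X\<^sub>T)\<close>, the tail of the convergent integral \<open>v\<^sub>\<pi> x\<close>.\<close>
  show "((\<lambda>t. \<gamma> powr t * v (state_under f \<pi> x t)) \<longlongrightarrow> 0) at_top"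
  proof (rule tendsto_sandwich[OF _ _ lower discounted_bound_tendsto])
    show "eventually (\<lambda>T. w x - integral {0..T} (reward_at \<pi> x)
        \<le> \<gamma> powr T * v (state_under f \<pi> x T)) at_top"
      using eventually_ge_at_top[of 0]
    proof eventually_elim
      case (elim T)
      have "w (state_under f \<pi> x T) \<le> v (state_under f \<pi> x T)"
        using le w by (metis ereal_less_eq(3))
      then show ?case
        unfolding value_at_state[OF pol elim w w, symmetric] by (intro mult_left_mono) auto
    qed
    show "eventually (\<lambda>t. \<gamma> powr t * v (state_under f \<pi> x t) \<le> \<gamma> powr t * c) at_top"
      by (intro always_eventually allI mult_left_mono v_le) auto
  qed
qed

section \<open>Greedy policies\<close>

context
  fixes \<pi> :: "real^'l \<Rightarrow> real^'m"
  assumes pol: "policy U \<pi>" and greedy: "\<And>x. greedy_action U f r x (grad v x) (\<pi> x)"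
begin

text \<open>By the finite-horizon identity the collected reward is \<open>v x\<close> minus the
  terminal term, and that term is at most \<open>\<gamma> powr T * c\<close>, which tends to
  0.\<close>

lemma greedy_value_ge: "ereal (v x) \<le> value_function f r \<gamma> \<pi> x"
proof (rule tendsto_le[OF _ value_tendsto(1)[OF pol]])
  have "((\<lambda>T. v x - \<gamma> powr T * c) \<longlongrightarrow> v x - 0) at_top"
    by (intro tendsto_intros discounted_bound_tendsto)
  then show "((\<lambda>T. ereal (v x - \<gamma> powr T * c)) \<longlongrightarrow> ereal (v x)) at_top" by simp
  show "eventually (\<lambda>T. ereal (v x - \<gamma> powr T * c)
      \<le> ereal (integral {0..T} (reward_at \<pi> x))) at_top"
    using eventually_ge_at_top[of 0]
  proof eventually_elim
    case (elim T)
    have "\<gamma> powr T * v (state_under f \<pi> x T) \<le> \<gamma> powr T * c"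
      by (intro mult_left_mono v_le) auto
    then show ?case using HJB_integral_eq[OF pol elim greedy, of x] by simp
  qed
qed simp

text \<open>The value lies above the real number \<open>v x\<close> and is never
  \<open>\<infinity>\<close>.\<close>

lemma greedy_admissible: "admissible U f r \<gamma> \<pi>"
  unfolding admissible_def
proof (intro conjI allI)
  fix x show "\<bar>value_function f r \<gamma> \<pi> x\<bar> \<noteq> \<infinity>"
    using greedy_value_ge[of x] value_tendsto(2)[OF pol, of x]
    by (cases "value_function f r \<gamma> \<pi> x") auto
qed (fact pol)

lemma greedy_value_le_of_reward_le:
  assumes kappa: "0 < \<kappa>" and le: "\<And>x. r x (\<pi> x) \<le> \<kappa> * v x"
  shows "value_function f r \<gamma> \<pi> x \<le> ereal (v x)"
proof (rule ccontr)
  \<comment> \<open>If \<open>v\<^sub>\<pi> x\<close> exceeded \<open>v x\<close>, then \<open>\<gamma>\<^sup>t v (X\<^sub>t)\<close> would have a negative limit, so the discounted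
    reward would eventually stay below a negative constant and its integral would diverge.\<close>
  let ?G = "\<lambda>T. integral {0..T} (reward_at \<pi> x)"
  let ?\<phi> = "\<lambda>T. \<gamma> powr T * v (state_under f \<pi> x T)"
  obtain V where V: "value_function f r \<gamma> \<pi> x = ereal V"
    using greedy_admissible unfolding admissible_def by (metis ereal_real')
  \<comment> \<open>Half the gap: \<open>?\<phi>\<close> tends to \<open>v x - V\<close>, that is
    \<open>- 2 * d\<close>, hence is eventually below \<open>- d\<close>.\<close>
  define d where "d = (V - v x) / 2"
  assume "\<not> ?thesis"
  then have d: "0 < d" unfolding V d_def by simp
  have "((\<lambda>T. ereal (?G T)) \<longlongrightarrow> ereal V) at_top"
    using value_tendsto(1)[OF pol, of x] unfolding V .
  then have G: "(?G \<longlongrightarrow> V) at_top" by simp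
  then have "eventually (\<lambda>T. V - d < ?G T) at_top"
    using d by (intro order_tendstoD) auto
  then obtain S where S: "\<And>T. S \<le> T \<Longrightarrow> V - d < ?G T"
    unfolding eventually_at_top_linorder by blast
  \<comment> \<open>The finite-horizon identity needs nonnegative times, which \<open>S\<close>
    alone does not ensure.\<close>
  define S' where "S' = max S 0"
  have S': "0 \<le> S'" "S \<le> S'" by (auto simp: S'_def)
  have rew: "reward_at \<pi> x t \<le> - (\<kappa> * d)" if "S' \<le> t" for t
  proof -
    have "?\<phi> t < - d"
      using HJB_integral_eq[OF pol _ greedy, of t x] S[of t] S' that by (simp add: d_def field_simps)
    then have "\<kappa> * ?\<phi> t \<le> \<kappa> * - d"
      using kappa by (intro mult_left_mono) auto
    moreover have "reward_at \<pi> x t \<le> \<gamma> powr t * (\<kappa> * v (state_under f \<pi> x t))"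
      by (intro mult_left_mono le) auto
    ultimately show ?thesis by (simp add: algebra_simps)
  qed
  \<comment> \<open>From \<open>S'\<close> on, the collected reward falls at least linearly with
    slope \<open>\<kappa> * d\<close>.\<close>
  have G_le: "?G T \<le> ?G S' - \<kappa> * d * (T - S')" if T: "S' \<le> T" for T
  proof -
    have "integral {S'..T} (reward_at \<pi> x) \<le> integral {S'..T} (\<lambda>_. - (\<kappa> * d))"
      by (intro integral_le reward_integrable pol S') (auto intro: rew)
    moreover have "?G S' + integral {S'..T} (reward_at \<pi> x) = ?G T"
      using S' T by (intro Henstock_Kurzweil_Integration.integral_combine reward_integrable pol) auto
    ultimately show ?thesis using T by (simp add: mult_ac)
  qed
  \<comment> \<open>At this time the linear bound has dropped by enough to give
    \<open>?G T \<le> V - d\<close>, against the choice of \<open>S\<close>.\<close>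
  define T where "T = S' + (\<bar>?G S'\<bar> + \<bar>V\<bar> + d) / (\<kappa> * d)"
  have kd: "0 < \<kappa> * d" using kappa d by simp
  then have T: "S' \<le> T" using d by (simp add: T_def)
  have "\<kappa> * d * (T - S') = \<bar>?G S'\<bar> + \<bar>V\<bar> + d" using kappa d by (simp add: T_def)
  moreover have "V - d < ?G T" using S S' T by simp
  ultimately show False using G_le[OF T] by linarith
qed

end
end
end
end

section \<open>Assembly of the claims\<close>

theorem theoremE1:
  fixes U :: "(real^'m) set"
    and f :: "real^'l \<Rightarrow> real^'m \<Rightarrow> real^'l"
    and r :: "real^'l \<Rightarrow> real^'m \<Rightarrow> real"
    and \<gamma> \<alpha> r_max :: real
    and v_star :: "real^'l \<Rightarrow> real"
    and \<pi>_star :: "real^'l \<Rightarrow> real^'m"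
  assumes action_space: "\<exists>Q. open Q \<and> (U = Q \<union> frontier Q \<or> U = Q)"
    and f_cont: "continuous_on (UNIV \<times> U) (\<lambda>(x, u). f x u)"
    and open_loop: "\<And>a. action_trajectory U a \<Longrightarrow> uniquely_solvable (\<lambda>t y. f y (a t))"
    and closed_loop: "\<And>\<pi>. policy U \<pi> \<Longrightarrow> uniquely_solvable (\<lambda>t y. f y (\<pi> y))"
    and r_cont: "continuous_on (UNIV \<times> U) (\<lambda>(x, u). r x u)"
    and gamma: "0 < \<gamma>" "\<gamma> \<le> 1"
    and alpha: "\<alpha> = - ln \<gamma>"
    and r_max_attained: "\<exists>x. \<exists>u\<in>U. r x u = r_max"
    and r_max_bound: "\<And>x u. u \<in> U \<Longrightarrow> r x u \<le> r_max"
    and r_max_zero: "\<gamma> = 1 \<Longrightarrow> r_max = 0"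
    and admissible_exists: "\<exists>\<pi>. admissible U f r \<gamma> \<pi>"
    and admissible_C1: "\<And>v. v \<in> admissible_VFs U f r \<gamma> \<Longrightarrow> C1 v"
    and greedy_selector: "\<exists>u_star. continuous_on UNIV (\<lambda>(x, p). u_star x p) \<and>
           (\<forall>x p. greedy_action U f r x p (u_star x p))"
    and v_star_C1: "C1 v_star"
    and v_star_HJB: "HJB_solution U f r \<alpha> v_star"
    and v_star_bounded: "\<exists>c. \<forall>x. v_star x \<le> c"
    and v_star_nonpos: "\<gamma> = 1 \<Longrightarrow> \<forall>x. v_star x \<le> 0"
    and pi_star_policy: "policy U \<pi>_star"
    and pi_star_greedy: "\<And>x. greedy_action U f r x (grad v_star x) (\<pi>_star x)"
  shows
    "(admissible U f r \<gamma> \<pi>_star \<and> (\<forall>x. ereal (v_star x) \<le> value_function f r \<gamma> \<pi>_star x))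
     \<and>
     (\<forall>\<pi>. policy U \<pi> \<and> boundary_condition f \<gamma> v_star \<pi>
        \<longrightarrow> (\<forall>x. value_function f r \<gamma> \<pi> x \<le> ereal (v_star x)))
     \<and>
     (\<forall>\<pi>. admissible U f r \<gamma> \<pi> \<and> (\<forall>x. value_function f r \<gamma> \<pi> x \<le> ereal (v_star x))
        \<longrightarrow> boundary_condition f \<gamma> v_star \<pi>)
     \<and>
     (boundary_condition f \<gamma> v_star \<pi>_star \<or> (\<exists>\<kappa>>0. \<forall>x. r x (\<pi>_star x) \<le> \<kappa> * v_star x)
        \<longrightarrow> (\<forall>x. ereal (v_star x) = value_function f r \<gamma> \<pi>_star x))
     \<and>
     ((\<forall>v\<in>admissible_VFs U f r \<gamma>. \<forall>x. v x \<le> v_star x)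
        \<longrightarrow> (\<forall>x. value_function f r \<gamma> \<pi>_star x = ereal (v_star x)) \<and>
            (\<forall>v\<in>admissible_VFs U f r \<gamma>. \<forall>x. v x \<le> v_star x))"
proof -
  \<comment> \<open>The maximum of the reward may be negative, whereas the locale asks for a
    nonnegative bound.\<close>
  define M where "M = max r_max 0"
  interpret discounted_system U f r \<gamma> M
  proof
    show "r x u \<le> M" if "u \<in> U" for x u
      using r_max_bound[OF that, of x] by (simp add: M_def)
    show "0 \<le> M" "\<gamma> = 1 \<Longrightarrow> M = 0"
      using r_max_zero by (simp_all add: M_def)
  qed (fact closed_loop r_cont gamma)+
  \<comment> \<open>One constant covers both cases: 0 for \<gamma> = 1, any upper bound of
    \<open>v_star\<close> otherwise.\<close>
  obtain c where c: "\<And>x. v_star x \<le> c" "\<gamma> = 1 \<Longrightarrow> c = 0"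
  proof (cases "\<gamma> = 1")
    case True
    then show ?thesis using v_star_nonpos that[of 0] by simp
  next
    case False
    then show ?thesis using v_star_bounded that by auto
  qed
  note HJB = v_star_C1 v_star_HJB[unfolded alpha]
  note greedy = HJB c pi_star_policy pi_star_greedy
  have adm: "admissible U f r \<gamma> \<pi>_star"
    by (rule greedy_admissible[OF greedy])
  have ge: "ereal (v_star x) \<le> value_function f r \<gamma> \<pi>_star x" for x
    by (rule greedy_value_ge[OF greedy])
  have bc_le: "value_function f r \<gamma> \<pi> x \<le> ereal (v_star x)"
    if "policy U \<pi>" "boundary_condition f \<gamma> v_star \<pi>" for \<pi> x
    by (rule value_le_of_boundary_condition[OF HJB that])
  have le_bc: "boundary_condition f \<gamma> v_star \<pi>"
    if "admissible U f r \<gamma> \<pi>" "\<forall>x. value_function f r \<gamma> \<pi> x \<le> ereal (v_star x)" for \<pi>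
    by (rule boundary_condition_of_value_le[OF HJB c that(1)]) (use that(2) in auto)
  have c_part: "ereal (v_star x) = value_function f r \<gamma> \<pi>_star x"
    if "boundary_condition f \<gamma> v_star \<pi>_star \<or> (\<exists>\<kappa>>0. \<forall>x. r x (\<pi>_star x) \<le> \<kappa> * v_star x)" for x
    using that
  proof
    assume "boundary_condition f \<gamma> v_star \<pi>_star"
    then show ?thesis by (intro antisym ge bc_le pi_star_policy)
  next
    assume "\<exists>\<kappa>>0. \<forall>x. r x (\<pi>_star x) \<le> \<kappa> * v_star x"
    then show ?thesis by (auto intro!: antisym ge intro: greedy_value_le_of_reward_le[OF greedy])
  qed
  have d_part: "value_function f r \<gamma> \<pi>_star x = ereal (v_star x)"
    if "\<forall>v\<in>admissible_VFs U f r \<gamma>. \<forall>x. v x \<le> v_star x" for x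
  proof -
    \<comment> \<open>By (a) the value of the greedy policy is itself an admissible VF, so the
      assumed domination applies to it and gives the inequality opposite to
      \<open>ge\<close>.\<close>
    define w where "w y = real_of_ereal (value_function f r \<gamma> \<pi>_star y)" for y
    have w: "value_function f r \<gamma> \<pi>_star y = ereal (w y)" for y
      using adm unfolding w_def admissible_def by (simp add: ereal_real')
    then have "w \<in> admissible_VFs U f r \<gamma>"
      using adm unfolding admissible_VFs_def by blast
    then show ?thesis using that ge[of x] unfolding w by (auto intro: antisym)
  qed
  show ?thesis
    using adm ge bc_le le_bc c_part d_part by blast
qed

end
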